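(* Let $n\ge 2$ and let $\{f_i\}_{i=1}^k$ be a sequence of vectors in $\mathbb{R}^n$, not all of which are zero. Then $\{f_i\}_{i=1}^k$ is a tight frame for $\mathbb{R}^n$ if and only if $\sum_{i=1}^k\tilde f_i=0$.
   Context: $\mathbb{R}^n$ carries its standard inner product; $f(i)$ denotes the $i$-th coordinate of $f$. A finite sequence $\{f_i\}_{i=1}^k$ in $\mathbb{R}^n$ is a tight frame if there is $\lambda>0$ with $\sum_{i=1}^k|\langle f,f_i\rangle|^2=\lambda\|f\|^2$ for all $f\in\mathbb{R}^n$. Diagram vector ($n\ge2$): for $f\in\mathbb{R}^n$, $\tilde f\in\mathbb{R}^{n(n-1)}$ is $\frac{1}{\sqrt{n-1}}$ times the vector whose entries are $f(i)^2-f(j)^2$ (once for each pair $i<j$) and $\sqrt{2n}\,f(i)f(j)$ (once for each pair $i<j$), in a fixed order that is the same for all $f$. *)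

theory Defs
  imports "HOL-Analysis.Analysis" "HOL-Library.Cardinality"
begin

definition tight_frame :: "nat \<Rightarrow> (nat \<Rightarrow> real ^ 'n) \<Rightarrow> bool" where
  "tight_frame k f \<longleftrightarrow>
     (\<exists>c>0. \<forall>g. (\<Sum>i=1..k. \<bar>g \<bullet> f i\<bar>\<^sup>2) = c * (norm g)\<^sup>2)"

(* The coordinates of R^n are indexed by a finite linearly ordered type 'n; class card2 says
   CARD('n) >= 2.  The n(n-1) coordinates of a diagram vector are two copies of the pairs i < j:
   the left copy for the differences of squares, the right copy for the products.  As the
   coordinates of a vector in real ^ 'm are labelled by 'm, they need no further ordering. *)

definition ordered_pairs :: "('n :: linorder \<times> 'n) set" where
  "ordered_pairs = {(i, j). i < j}"

lemma ordered_pairs_nonempty: "(ordered_pairs :: ('n :: {card2, linorder} \<times> 'n) set) \<noteq> {}"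
proof -
  have "\<not> (\<forall>x y :: 'n. x = y)"
  proof
    assume "\<forall>x y :: 'n. x = y"
    then have "(UNIV :: 'n set) = {undefined}" by auto
    then have "CARD('n) = 1" by (metis card_1_singleton_iff One_nat_def)
    then show False using two_le_card[where 'a = 'n] by simp
  qed
  then show ?thesis unfolding ordered_pairs_def by (auto simp: neq_iff)
qed

typedef (overloaded) ('n :: "{card2, linorder}") diagram_index =
  "(ordered_pairs :: ('n \<times> 'n) set) <+> (ordered_pairs :: ('n \<times> 'n) set)"
  using ordered_pairs_nonempty by blast

instance diagram_index :: ("{card2, linorder}") finite
proof
  have "inj_on Rep_diagram_index (UNIV :: 'a diagram_index set)"
    by (simp add: inj_on_def Rep_diagram_index_inject)
  then show "finite (UNIV :: 'a diagram_index set)"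
    by (rule finite_imageD[rotated]) simp
qed

lemma card_ordered_pairs:
  "2 * card (ordered_pairs :: ('n :: {finite, linorder} \<times> 'n) set) = CARD('n) * (CARD('n) - 1)"
proof -
  let ?P = "ordered_pairs :: ('n \<times> 'n) set"
  let ?D = "range (\<lambda>i :: 'n. (i, i))"
  have swap: "card (prod.swap ` ?P) = card ?P"
    by (rule card_image) (auto simp: inj_on_def)
  have diag: "card ?D = CARD('n)"
    by (rule card_image) (simp add: inj_on_def)
  have un: "(?P \<union> prod.swap ` ?P) \<union> ?D = UNIV"
    by (force simp: ordered_pairs_def image_iff)
  have disj: "?P \<inter> prod.swap ` ?P = {}" "(?P \<union> prod.swap ` ?P) \<inter> ?D = {}"
    by (auto simp: ordered_pairs_def)
  have "card ?P + card ?P + CARD('n) = card ((?P \<union> prod.swap ` ?P) \<union> ?D)"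
    using disj by (simp add: card_Un_disjoint swap diag)
  also have "\<dots> = CARD('n) * CARD('n)"
    unfolding un by simp
  finally show ?thesis
    by (simp add: diff_mult_distrib2)
qed

lemma card_diagram_index:
  "CARD('n :: {card2, linorder} diagram_index) = CARD('n) * (CARD('n) - 1)"
  using card_ordered_pairs[where 'n = 'n]
    type_definition.card[OF type_definition_diagram_index[where 'n = 'n]]
  by (simp add: card_Plus)

definition diagram_vector :: "real ^ 'n :: {card2, linorder} \<Rightarrow> real ^ 'n diagram_index" where
  "diagram_vector f =
     (1 / sqrt (real CARD('n) - 1)) *\<^sub>R
     (\<chi> p. case Rep_diagram_index p of
            Inl (i, j) \<Rightarrow> (f $ i)\<^sup>2 - (f $ j)\<^sup>2
          | Inr (i, j) \<Rightarrow> sqrt (2 * real CARD('n)) * (f $ i) * (f $ j))"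

end

theory Submission
  imports Defs
begin

text \<open>Let \<open>S = \<Sum>\<^sub>t f\<^sub>t f\<^sub>t\<^sup>T\<close> be the frame operator. Up to nonzero factors, the entries of the sum of
  the diagram vectors are \<open>S\<^sub>i\<^sub>i - S\<^sub>j\<^sub>j\<close> and \<open>S\<^sub>i\<^sub>j\<close> for \<open>i < j\<close>, so the sum vanishes iff
  \<open>S\<close> is a multiple of the identity. The factor is positive since the trace of \<open>S\<close> is
  \<open>\<Sum>\<^sub>t \<parallel>f\<^sub>t\<parallel>\<^sup>2\<close>.\<close>

definition frame_matrix :: "nat \<Rightarrow> (nat \<Rightarrow> real ^ 'n) \<Rightarrow> 'n \<Rightarrow> 'n \<Rightarrow> real" where
  "frame_matrix k f i j = (\<Sum>t=1..k. f t $ i * f t $ j)"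

lemma frame_matrix_commute: "frame_matrix k f i j = frame_matrix k f j i"
  unfolding frame_matrix_def by (simp add: mult.commute)

lemma sum_inner_squared_eq_frame_matrix:
  "(\<Sum>t=1..k. \<bar>g \<bullet> f t\<bar>\<^sup>2) = (\<Sum>i\<in>UNIV. \<Sum>j\<in>UNIV. g $ i * g $ j * frame_matrix k f i j)"
proof -
  have "(\<Sum>t=1..k. \<bar>g \<bullet> f t\<bar>\<^sup>2)
      = (\<Sum>t=1..k. \<Sum>i\<in>UNIV. \<Sum>j\<in>UNIV. g $ i * g $ j * (f t $ i * f t $ j))"
    by (simp add: inner_vec_def power2_eq_square sum_product mult_ac)
  also have "\<dots> = (\<Sum>i\<in>UNIV. \<Sum>j\<in>UNIV. \<Sum>t=1..k. g $ i * g $ j * (f t $ i * f t $ j))"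
    by (subst sum.swap, rule sum.cong[OF refl], rule sum.swap)
  finally show ?thesis
    by (simp add: frame_matrix_def sum_distrib_left)
qed

lemma sum_frame_matrix_diagonal:
  "(\<Sum>i\<in>UNIV. frame_matrix k f i i) = (\<Sum>t=1..k. (norm (f t))\<^sup>2)"
  unfolding frame_matrix_def power2_norm_eq_inner inner_vec_def
  by (subst sum.swap) simp

text \<open>Tightness says that the quadratic form of the frame matrix is \<open>c\<close> times the
  squared norm. By polarization a form determines its symmetric matrix, so the matrix must be
  \<open>c\<close> times the identity.\<close>

lemma tight_frame_iff_frame_matrix:
  "tight_frame k f \<longleftrightarrow> (\<exists>c>0. \<forall>i j. frame_matrix k f i j = (if i = j then c else 0))"
proof
  assume "tight_frame k f"
  then obtain c where "c > 0"
    and c: "\<And>g. (\<Sum>t=1..k. \<bar>g \<bullet> f t\<bar>\<^sup>2) = c * (norm g)\<^sup>2"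
    unfolding tight_frame_def by blast
  have diag: "frame_matrix k f i i = c" for i
    using c[of "axis i 1"]
    by (simp add: inner_axis' frame_matrix_def power2_eq_square)
  have "frame_matrix k f i j = 0" if "i \<noteq> j" for i j
  proof -
    \<comment> \<open>Polarization: the test vector is the sum of two orthogonal unit vectors, whose
      squared norm is 2.\<close>
    have "axis i (1::real) $ j = 0" "axis j (1::real) $ i = 0"
      using that by (simp_all add: axis_def)
    then have "(\<Sum>t=1..k. (f t $ i + f t $ j)\<^sup>2) = c * 2"
      using c[of "axis i 1 + axis j 1"]
      by (simp add: inner_axis' inner_add_left inner_add_right power2_norm_eq_inner)
    moreover have "(\<Sum>t=1..k. (f t $ i + f t $ j)\<^sup>2)
        = frame_matrix k f i i + frame_matrix k f j j + 2 * frame_matrix k f i j"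
      by (simp add: frame_matrix_def sum_distrib_left sum.distrib[symmetric] power2_eq_square
          algebra_simps)
    ultimately show ?thesis by (simp add: diag)
  qed
  with diag \<open>c > 0\<close> show "\<exists>c>0. \<forall>i j. frame_matrix k f i j = (if i = j then c else 0)"
    by auto
next
  assume "\<exists>c>0. \<forall>i j. frame_matrix k f i j = (if i = j then c else 0)"
  then obtain c where "c > 0"
    and c: "\<And>i j. frame_matrix k f i j = (if i = j then c else 0)" by blast
  have "(\<Sum>t=1..k. \<bar>g \<bullet> f t\<bar>\<^sup>2) = c * (norm g)\<^sup>2" for g
    unfolding sum_inner_squared_eq_frame_matrix c
    by (simp add: if_distrib[of "(*) _"] power2_norm_eq_inner inner_vec_def sum_distrib_left
        mult_ac cong: if_cong)
  with \<open>c > 0\<close> show "tight_frame k f"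
    unfolding tight_frame_def by blast
qed

text \<open>Replaces the abstract index type by pairs \<open>i < j\<close>. The predicate lives on
  the underlying sum type, so that the case distinction in \<open>diagram_vector\<close> can be
  substituted for \<open>P\<close>.\<close>

lemma all_diagram_index_iff:
  "(\<forall>p :: 'n :: {card2, linorder} diagram_index. P (Rep_diagram_index p)) \<longleftrightarrow>
    (\<forall>i j :: 'n. i < j \<longrightarrow> P (Inl (i, j)) \<and> P (Inr (i, j)))"
proof -
  have "(\<forall>p :: 'n diagram_index. P (Rep_diagram_index p)) \<longleftrightarrow>
      (\<forall>x \<in> ordered_pairs <+> ordered_pairs. P x)"
    by (metis Rep_diagram_index Rep_diagram_index_cases)
  then show ?thesis
    by (auto simp: ordered_pairs_def)
qed

lemma sum_diagram_vector_eq_0_iff: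
  fixes f :: "nat \<Rightarrow> real ^ 'n :: {card2, linorder}"
  shows "(\<Sum>t=1..k. diagram_vector (f t)) = 0 \<longleftrightarrow>
    (\<forall>i j. i < j \<longrightarrow> frame_matrix k f i i = frame_matrix k f j j \<and> frame_matrix k f i j = 0)"
proof -
  let ?D = "\<lambda>x v. case x of
            Inl (i, j) \<Rightarrow> (v $ i)\<^sup>2 - (v $ j)\<^sup>2
          | Inr (i, j) \<Rightarrow> sqrt (2 * real CARD('n)) * (v $ i) * (v $ j)"
  \<comment> \<open>The dimension is at least 2, so the normalizing scalar is nonzero and
    cancels.\<close>
  have "sqrt (real CARD('n) - 1) \<noteq> 0"
    using two_le_card[where 'a = 'n] by simp
  then have "(\<Sum>t=1..k. diagram_vector (f t)) = 0 \<longleftrightarrow>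
      (\<forall>p :: 'n diagram_index. (\<Sum>t=1..k. ?D (Rep_diagram_index p) (f t)) = 0)"
    by (simp add: diagram_vector_def scaleR_sum_right[symmetric] vec_eq_iff)
  also have "\<dots> \<longleftrightarrow> (\<forall>i j. i < j \<longrightarrow>
      (\<Sum>t=1..k. ?D (Inl (i, j)) (f t)) = 0 \<and> (\<Sum>t=1..k. ?D (Inr (i, j)) (f t)) = 0)"
    by (rule all_diagram_index_iff)
  also have "\<dots> \<longleftrightarrow> (\<forall>i j. i < j \<longrightarrow>
      frame_matrix k f i i = frame_matrix k f j j \<and> frame_matrix k f i j = 0)"
    by (simp add: frame_matrix_def sum_subtractf power2_eq_square mult.assoc
        sum_distrib_left[symmetric])
  finally show ?thesis .
qed

theorem proposition2p4:
  fixes k :: nat and f :: "nat \<Rightarrow> real ^ 'n :: {card2, linorder}"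
  assumes "\<exists>i\<in>{1..k}. f i \<noteq> 0"
  shows "tight_frame k f \<longleftrightarrow> (\<Sum>i=1..k. diagram_vector (f i)) = 0"
proof
  assume "tight_frame k f"
  then show "(\<Sum>i=1..k. diagram_vector (f i)) = 0"
    unfolding tight_frame_iff_frame_matrix sum_diagram_vector_eq_0_iff by auto
next
  assume "(\<Sum>i=1..k. diagram_vector (f i)) = 0"
  then have *: "frame_matrix k f i i = frame_matrix k f j j \<and> frame_matrix k f i j = 0"
    if "i < j" for i j
    using that unfolding sum_diagram_vector_eq_0_iff by blast
  \<comment> \<open>Here \<open>undefined\<close> is just an arbitrary index: any two distinct
    indices are comparable, so all diagonal entries agree.\<close>
  define c where "c = frame_matrix k f undefined undefined"
  have diag: "frame_matrix k f i i = c" for i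
    unfolding c_def by (metis * neq_iff)
  \<comment> \<open>Only entries with \<open>i < j\<close> are known to vanish; symmetry of the
    matrix gives the others.\<close>
  have off: "frame_matrix k f i j = 0" if "i \<noteq> j" for i j
    using that by (metis * neq_iff frame_matrix_commute)
  have "0 < (\<Sum>t=1..k. (norm (f t))\<^sup>2)"
    using assms by (auto intro: sum_pos2)
  \<comment> \<open>Both sides of the trace identity are compared: the diagonal is constant, so the
    trace is the dimension times \<open>c\<close>.\<close>
  then have "0 < real CARD('n) * c"
    by (simp only: sum_frame_matrix_diagonal[symmetric] diag sum_constant)
  then have "c > 0"
    by (simp add: zero_less_mult_iff)
  with diag off show "tight_frame k f"
    unfolding tight_frame_iff_frame_matrix by auto
qed

end
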